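(* Let $\chi_1(y)=\int_0^y\epsilon\,|\log|s/4||^{\alpha}\,ds$ with $\epsilon>0$ and $1/4<\alpha<1/2$, and let $\tilde\chi_2$ be a function of one variable satisfying $$\tilde\chi_2'-2(\chi_1')^2(1+\chi_1)^{-2}-\frac1{16}\tilde\chi_2^2=0 .$$ Let $g$ be the metric on $D$ (defined in the context) whose coefficients in the basis $\{L,\underline{L},\partial_2,\partial_3\}$ are $$g_{L\underline{L}}=-2,\qquad g_{\underline{L}\,\underline{L}}=-t\,\tilde\chi_2,\qquad g_{AB}=\delta_{AB}\,\chi_{1A},\qquad g_{A\underline{L}}=-\tfrac14 x_A\,\chi_{2A}\qquad(A,B\in\{2,3\}),$$ together with their symmetric counterparts, all other coefficients being zero, where $\chi_{12}=1+\chi_1=1/\chi_{13}$, $\chi_{2A}=\chi_{1A}\tilde\chi_2$, and all the functions $\chi_1,\chi_{1A},\chi_{2A},\tilde\chi_2$ are evaluated at $x_1-t$. Then the standard coordinates $(x_0,x_1,x_2,x_3)$, $x_0=t$, satisfy the wave coordinate condition $$\partial_\alpha\big(\sqrt{|g|}\,g^{\alpha\beta}\big)=0,\qquad \beta=0,1,2,3 .$$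
   Context: Coordinates on $\mathbb{R}^{1+3}$ are $(t,x_1,x_2,x_3)$; $L=\partial_t+\partial_{x_1}$, $\underline{L}=\partial_t-\partial_{x_1}$, $\partial_A=\partial_{x_A}$ for $A=2,3$; subscripts $L,\underline{L},2,3$ denote components with respect to these vector fields, e.g. $g_{L\underline{L}}=g(L,\underline{L})$. In the wave coordinate condition, $g^{\alpha\beta}$ is the inverse of the matrix $(g_{\alpha\beta})$ of components in the standard coordinates, $|g|=|\det(g_{\alpha\beta})|$, and the repeated index $\alpha$ is summed over $0,\dots,3$ (this index is unrelated to the exponent $\alpha$ in $\chi_1$). The domain is $$D=\{(t,x):\ (x_1-1)^2H(x_1-1)+x_2^2/4+x_3^2/4<(1-t)^2\},$$ where $H(x_1-1)=1$ when $x_1<1$ and $H(x_1-1)=1/4$ when $x_1>1$.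
   Formalization: As D also contains points with t>1, where x_1-t may be 0 (χ_1' infinite) or 1+χ_1 may vanish, the ODE is assumed, and the metric and conclusion are taken, only where x_1-t lies in an arbitrary open set I avoiding 0 and the zeros of 1+χ_1; I=(0,∞) gives all of D with t<1. *)

theory Defs
  imports "HOL-Analysis.Analysis"
begin

text \<open>
  Points and tangent vectors of \<open>\<real>\<^sup>1\<^sup>+\<^sup>3\<close> are elements of \<^typ>\<open>real^4\<close>. The elements of the index
  type \<^typ>\<open>4\<close> are \<open>0, 1, 2, 3\<close> (with \<open>4 = 0\<close>), so that \<open>p $ 0\<close> is \<open>t\<close> and \<open>p $ i\<close> is \<open>x\<^sub>i\<close>.
\<close>

definition vecL :: "real^4" where
  "vecL = axis 0 1 + axis 1 1"

definition vecLbar :: "real^4" where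
  "vecLbar = axis 0 1 - axis 1 1"

abbreviation vecd :: "4 \<Rightarrow> real^4" where
  "vecd i \<equiv> axis i 1"

text \<open>The value of \<open>H\<close> at \<open>0\<close> is immaterial: there it is multiplied by \<open>0\<close>.\<close>

definition H :: "real \<Rightarrow> real" where
  "H s = (if s < 0 then 1 else 1/4)"

definition D :: "(real^4) set" where
  "D = {p. (p$1 - 1)^2 * H (p$1 - 1) + (p$2)^2 / 4 + (p$3)^2 / 4 < (1 - p$0)^2}"

text \<open>The integral is oriented, i.e. it is minus the integral over \<open>[y, 0]\<close> if \<open>y < 0\<close>.\<close>

definition chi1 :: "real \<Rightarrow> real \<Rightarrow> real \<Rightarrow> real" where
  "chi1 \<epsilon> \<alpha> y = (LBINT s=0..y. \<epsilon> * \<bar>ln \<bar>s / 4\<bar>\<bar> powr \<alpha>)"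

text \<open>\<open>\<chi>\<^sub>1\<^sub>A\<close> and \<open>\<chi>\<^sub>2\<^sub>A\<close> are only used for \<open>A \<in> {2, 3}\<close>.\<close>

definition chi1A :: "real \<Rightarrow> real \<Rightarrow> 4 \<Rightarrow> real \<Rightarrow> real" where
  "chi1A \<epsilon> \<alpha> A y = (if A = 2 then 1 + chi1 \<epsilon> \<alpha> y else 1 / (1 + chi1 \<epsilon> \<alpha> y))"

definition chi2A :: "real \<Rightarrow> real \<Rightarrow> (real \<Rightarrow> real) \<Rightarrow> 4 \<Rightarrow> real \<Rightarrow> real" where
  "chi2A \<epsilon> \<alpha> \<chi>\<^sub>2 A y = chi1A \<epsilon> \<alpha> A y * \<chi>\<^sub>2 y"

definition ode_on :: "real \<Rightarrow> real \<Rightarrow> (real \<Rightarrow> real) \<Rightarrow> real set \<Rightarrow> bool" where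
  "ode_on \<epsilon> \<alpha> \<chi>\<^sub>2 I \<longleftrightarrow> (\<forall>y\<in>I. \<chi>\<^sub>2 differentiable (at y) \<and>
     deriv \<chi>\<^sub>2 y - 2 * (deriv (chi1 \<epsilon> \<alpha>) y)^2 * (1 + chi1 \<epsilon> \<alpha> y) powi (-2) - 1/16 * (\<chi>\<^sub>2 y)^2 = 0)"

text \<open>
  The part of \<open>D\<close> on which the coefficients are defined, if \<open>\<chi>\<^sub>2\<close> is a solution on \<open>I\<close>. As the
  equation for \<open>\<chi>\<^sub>2\<close> is of Riccati type, solutions need not be global. Moreover \<open>\<chi>\<^sub>1\<close> is not
  differentiable at \<open>0\<close>, and \<open>1 + \<chi>\<^sub>1\<close> may vanish at negative arguments; \<open>x\<^sub>1 - t\<close> is positive on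
  the part \<open>t < 1\<close> of \<open>D\<close> but takes all real values on the part \<open>t > 1\<close>. With \<open>I = {0<..}\<close> the
  domain contains all of \<open>D \<inter> {t < 1}\<close>, with \<open>I = {0<..<3}\<close> all of \<open>D \<inter> {0 \<le> t < 1}\<close>.
\<close>

definition D_on :: "real set \<Rightarrow> (real^4) set" where
  "D_on I = {p\<in>D. p$1 - p$0 \<in> I}"

definition is_metric_g ::
  "real \<Rightarrow> real \<Rightarrow> (real \<Rightarrow> real) \<Rightarrow> (real^4) set \<Rightarrow> (real^4 \<Rightarrow> real^4 \<Rightarrow> real^4 \<Rightarrow> real) \<Rightarrow> bool" where
  "is_metric_g \<epsilon> \<alpha> \<chi>\<^sub>2 M g \<longleftrightarrow> (\<forall>p\<in>M. let u = p$1 - p$0 in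
     bilinear (g p) \<and> (\<forall>X Y. g p X Y = g p Y X) \<and>
     g p vecL vecL = 0 \<and>
     g p vecL vecLbar = -2 \<and>
     g p vecLbar vecLbar = - (p$0) * \<chi>\<^sub>2 u \<and>
     (\<forall>A\<in>{2, 3}.
        g p vecL (vecd A) = 0 \<and>
        g p (vecd A) vecLbar = - (1/4) * p$A * chi2A \<epsilon> \<alpha> \<chi>\<^sub>2 A u \<and>
        (\<forall>B\<in>{2, 3}. g p (vecd A) (vecd B) = (if A = B then chi1A \<epsilon> \<alpha> A u else 0))))"

definition components :: "(real^4 \<Rightarrow> real^4 \<Rightarrow> real^4 \<Rightarrow> real) \<Rightarrow> real^4 \<Rightarrow> real^4^4" where
  "components g p = (\<chi> \<mu> \<nu>. g p (vecd \<mu>) (vecd \<nu>))"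

definition partial_differentiable :: "4 \<Rightarrow> (real^4 \<Rightarrow> real) \<Rightarrow> real^4 \<Rightarrow> bool" where
  "partial_differentiable \<mu> f p \<longleftrightarrow> (\<lambda>s. f (p + s *\<^sub>R vecd \<mu>)) differentiable (at 0)"

definition partial_deriv :: "4 \<Rightarrow> (real^4 \<Rightarrow> real) \<Rightarrow> real^4 \<Rightarrow> real" where
  "partial_deriv \<mu> f p = deriv (\<lambda>s. f (p + s *\<^sub>R vecd \<mu>)) 0"

text \<open>\<open>\<surd>|g| g\<^sup>\<mu>\<^sup>\<beta>\<close>\<close>

definition densitized_inverse ::
  "(real^4 \<Rightarrow> real^4 \<Rightarrow> real^4 \<Rightarrow> real) \<Rightarrow> 4 \<Rightarrow> 4 \<Rightarrow> real^4 \<Rightarrow> real" where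
  "densitized_inverse g \<mu> \<beta> p =
     sqrt \<bar>det (components g p)\<bar> * matrix_inv (components g p) $ \<mu> $ \<beta>"

text \<open>
  Invertibility and differentiability are included because \<^const>\<open>matrix_inv\<close> and \<^const>\<open>deriv\<close>
  have unspecified values where the inverse or derivative does not exist.
\<close>

definition wave_coordinate_condition ::
  "(real^4) set \<Rightarrow> (real^4 \<Rightarrow> real^4 \<Rightarrow> real^4 \<Rightarrow> real) \<Rightarrow> bool" where
  "wave_coordinate_condition M g \<longleftrightarrow> (\<forall>p\<in>M. invertible (components g p) \<and>
     (\<forall>\<beta>. (\<forall>\<mu>. partial_differentiable \<mu> (densitized_inverse g \<mu> \<beta>) p) \<and>
          (\<Sum>\<mu>\<in>UNIV. partial_deriv \<mu> (densitized_inverse g \<mu> \<beta>) p) = 0))"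

end

theory Submission
  imports Defs
begin

text \<open>
  With \<open>u = x\<^sub>1 - t\<close> and \<open>a\<^sub>A = \<chi>\<^sub>1\<^sub>A(u)\<close> the metric is
  \<open>-dt\<^sup>2 + dx\<^sub>1\<^sup>2 + \<Sum> a\<^sub>A dx\<^sub>A\<^sup>2\<close> plus twice the symmetric product of the null covector \<open>du\<close> with a
  covector \<open>m\<close> that vanishes on \<open>L\<close>. Its inverse is the inverse of the diagonal part plus twice the
  symmetric product of \<open>L\<close> with a vector \<open>w\<close>, and the determinant is \<open>-a\<^sub>2 a\<^sub>3 = -1\<close>. The
  diagonal part has divergence zero since \<open>u\<close> does not depend on \<open>x\<^sub>2, x\<^sub>3\<close>. So the wave coordinate
  condition reduces to \<open>L w\<^sup>\<beta> + (div w) L\<^sup>\<beta> = 0\<close>, where all derivatives of \<open>\<chi>\<^sub>1\<close> and \<open>\<chi>\<^sub>2\<close> cancel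
  because \<open>L u = 0\<close>.
\<close>

text \<open>Integrability of \<open>f\<close> near \<open>a\<close> is not needed, because the integral is \<open>0\<close> by convention where
  it does not exist. Hence the logarithmic singularity of \<open>\<chi>\<^sub>1'\<close> at \<open>0\<close> requires no estimate.\<close>

lemma interval_integral_differentiable:
  fixes f :: "real \<Rightarrow> real" and a y :: real
  assumes "open S" "y \<in> S" "continuous_on S f"
  shows "(\<lambda>x. LBINT s=a..x. f s) differentiable (at y)"
proof -
  obtain e where e: "e > 0" "cball y e \<subseteq> S"
    using assms(1,2) open_contains_cball by blast
  have cont: "continuous_on {y-e..y+e} f"
    using assms(3) e(2) by (rule_tac continuous_on_subset) (auto simp: cball_eq_atLeastAtMost)
  have int: "set_integrable lborel {y-e..y+e} f"
    by (rule borel_integrable_atLeastAtMost'[OF cont])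
  have glue: "set_integrable lborel (einterval b c) f"
    if "set_integrable lborel A f" "A \<in> sets lborel" "einterval b c \<subseteq> A \<union> {y-e..y+e}" for A b c
    by (rule set_integrable_subset[OF set_integrable_Un[OF that(1) int]]) (use that in auto)
  have deriv: "((\<lambda>u. LBINT s=y..u. f s) has_vector_derivative f y) (at y)"
    using interval_integral_FTC2[of "y-e" y "y+e" f y] cont e(1)
    by (simp add: at_within_Icc_at)
  show ?thesis
  proof (cases "interval_lebesgue_integrable lborel a y f")
    case True
    have eq: "(LBINT s=a..x. f s) = (LBINT s=a..y. f s) + (LBINT s=y..x. f s)"
      if x: "x \<in> {y-e<..<y+e}" for x
    proof (rule interval_integral_sum[symmetric])
      have "set_integrable lborel (einterval (min a y) (max a y)) f"
        using True by (auto simp: interval_lebesgue_integrable_def min_def max_def split: if_splits)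
      then have "set_integrable lborel (einterval (min a (min y x)) (max a (max y x))) f"
        by (rule glue) (use x in \<open>auto simp: einterval_eq min_def max_def split: if_splits\<close>)
      moreover have "min (ereal a) (min (ereal y) (ereal x)) \<le> max (ereal a) (max (ereal y) (ereal x))"
        by (simp add: min_le_iff_disj le_max_iff_disj)
      ultimately show "interval_lebesgue_integrable lborel
          (min (ereal a) (min (ereal y) (ereal x))) (max (ereal a) (max (ereal y) (ereal x))) f"
        by (simp add: interval_lebesgue_integrable_def)
    qed
    have "((\<lambda>x. (LBINT s=a..y. f s) + (LBINT s=y..x. f s)) has_vector_derivative f y) (at y)"
      using deriv by (auto intro!: derivative_eq_intros)
    then have "((\<lambda>x. LBINT s=a..x. f s) has_vector_derivative f y) (at y)"
      by (rule has_vector_derivative_transform_within_open[of _ _ _ "{y-e<..<y+e}"])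
        (simp_all only: eq, use e(1) in auto)
    then show ?thesis
      by (rule differentiableI_vector)
  next
    case False
    have zero: "(LBINT s=a..x. f s) = 0" if x: "x \<in> {y-e<..<y+e}" for x
    proof -
      have "\<not> set_integrable lborel (einterval (min a x) (max a x)) f"
      proof
        assume "set_integrable lborel (einterval (min a x) (max a x)) f"
        then have "set_integrable lborel (einterval (min a y) (max a y)) f"
          by (rule glue) (use x in \<open>auto simp: einterval_eq min_def max_def split: if_splits\<close>)
        with False show False
          by (auto simp: interval_lebesgue_integrable_def min_def max_def split: if_splits)
      qed
      then show ?thesis
        by (cases "a \<le> x") (simp_all add: interval_lebesgue_integral_def set_lebesgue_integral_def
            set_integrable_def not_integrable_integral_eq)
    qed
    have "((\<lambda>x. LBINT s=a..x. f s) has_vector_derivative 0) (at y)"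
      by (rule has_vector_derivative_transform_within_open[of "\<lambda>_. 0" _ _ "{y-e<..<y+e}"])
        (use e(1) zero in auto)
    then show ?thesis
      by (rule differentiableI_vector)
  qed
qed

lemma chi1_differentiable:
  assumes "\<alpha> > 0" "y \<noteq> 0"
  shows "chi1 \<epsilon> \<alpha> differentiable (at y)"
proof -
  have "(\<lambda>x. LBINT s=(0::real)..x. \<epsilon> * \<bar>ln \<bar>s / 4\<bar>\<bar> powr \<alpha>) differentiable (at y)"
    by (rule interval_integral_differentiable[of "-{0}"])
      (use assms in \<open>auto intro!: continuous_intros continuous_on_powr'\<close>)
  then show ?thesis
    by (simp add: chi1_def[abs_def] zero_ereal_def)
qed

lemma UNIV_4_from_0: "(UNIV :: 4 set) = {0, 1, 2, 3}"
  using UNIV_4 by auto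

lemma forall_4_from_0: "(\<forall>i::4. P i) \<longleftrightarrow> P 0 \<and> P 1 \<and> P 2 \<and> P 3"
  using UNIV_4_from_0 by (metis UNIV_I empty_iff insert_iff)

lemma sum_4_from_0: "sum f (UNIV :: 4 set) = f 0 + f 1 + f 2 + f 3"
  unfolding UNIV_4_from_0 by (simp add: add_ac)

lemma det_4:
  "det (A :: 'a::comm_ring_1^4^4) =
     A$0$0 * (A$1$1 * (A$2$2 * A$3$3 - A$2$3 * A$3$2) - A$1$2 * (A$2$1 * A$3$3 - A$2$3 * A$3$1)
       + A$1$3 * (A$2$1 * A$3$2 - A$2$2 * A$3$1))
   - A$0$1 * (A$1$0 * (A$2$2 * A$3$3 - A$2$3 * A$3$2) - A$1$2 * (A$2$0 * A$3$3 - A$2$3 * A$3$0)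
       + A$1$3 * (A$2$0 * A$3$2 - A$2$2 * A$3$0))
   + A$0$2 * (A$1$0 * (A$2$1 * A$3$3 - A$2$3 * A$3$1) - A$1$1 * (A$2$0 * A$3$3 - A$2$3 * A$3$0)
       + A$1$3 * (A$2$0 * A$3$1 - A$2$1 * A$3$0))
   - A$0$3 * (A$1$0 * (A$2$1 * A$3$2 - A$2$2 * A$3$1) - A$1$1 * (A$2$0 * A$3$2 - A$2$2 * A$3$0)
       + A$1$2 * (A$2$0 * A$3$1 - A$2$1 * A$3$0))"
proof -
  have f: "finite {1::4, 2, 3}" "0 \<notin> {1::4, 2, 3}"
    "finite {2::4, 3}" "1 \<notin> {2::4, 3}" "finite {3::4}" "2 \<notin> {3::4}"
    by auto
  show ?thesis
    unfolding det_def UNIV_4_from_0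
    unfolding sum_over_permutations_insert[OF f(1,2)] sum_over_permutations_insert[OF f(3,4)]
      sum_over_permutations_insert[OF f(5,6)]
    unfolding permutes_sing
    by (simp add: sign_swap_id permutation_swap_id sign_compose sign_id swap_id_eq
        transpose_def permutation_compose algebra_simps)
qed

lemma open_D: "open D"
proof -
  have "x\<^sup>2 * H x = (min x 0)\<^sup>2 + (max x 0)\<^sup>2 / 4" for x
    by (auto simp: H_def min_def max_def)
  then have "D = {p. (min (p$1 - 1) 0)\<^sup>2 + (max (p$1 - 1) 0)\<^sup>2 / 4 + (p$2)\<^sup>2 / 4 + (p$3)\<^sup>2 / 4
      < (1 - p$0)\<^sup>2}"
    by (simp add: D_def)
  also have "open \<dots>"
    by (intro open_Collect_less continuous_intros) auto
  finally show ?thesis .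
qed

lemma open_D_on:
  assumes "open I"
  shows "open (D_on I)"
proof -
  have "open ((\<lambda>p::real^4. p$1 - p$0) -` I)"
    by (intro open_vimage assms continuous_intros)
  then have "open (D \<inter> (\<lambda>p. p$1 - p$0) -` I)"
    using open_D by blast
  also have "D \<inter> (\<lambda>p. p$1 - p$0) -` I = D_on I"
    by (auto simp: D_on_def)
  finally show ?thesis .
qed

definition Lcomp :: "4 \<Rightarrow> real" where
  "Lcomp \<mu> = (if \<mu> \<in> {0, 1} then 1 else 0)"

definition du :: "4 \<Rightarrow> real" where
  "du \<mu> = (if \<mu> = 0 then -1 else if \<mu> = 1 then 1 else 0)"

definition diagonal_part :: "(4 \<Rightarrow> real) \<Rightarrow> 4 \<Rightarrow> 4 \<Rightarrow> real" where
  "diagonal_part a \<mu> \<nu> = (if \<mu> \<noteq> \<nu> then 0 else if \<mu> = 0 then -1 else if \<mu> = 1 then 1 else a \<mu>)"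

text \<open>\<open>lower_coeff\<close> and \<open>upper_coeff\<close> are the components of the covector \<open>m\<close> and of the vector
  \<open>w\<close>.\<close>

definition lower_coeff :: "(4 \<Rightarrow> real \<Rightarrow> real) \<Rightarrow> (real \<Rightarrow> real) \<Rightarrow> real^4 \<Rightarrow> 4 \<Rightarrow> real" where
  "lower_coeff a h p \<mu> = (let u = p$1 - p$0 in
     if \<mu> \<in> {0, 1} then - du \<mu> * p$0 * h u / 8 else a \<mu> u * p$\<mu> * h u / 8)"

definition upper_coeff :: "(4 \<Rightarrow> real \<Rightarrow> real) \<Rightarrow> (real \<Rightarrow> real) \<Rightarrow> real^4 \<Rightarrow> 4 \<Rightarrow> real" where
  "upper_coeff a h p \<mu> = (let u = p$1 - p$0 in
     if \<mu> \<in> {0, 1} then p$0 * h u / 8 + (h u)\<^sup>2 * (\<Sum>A\<in>{2, 3}. a A u * (p$A)\<^sup>2) / 128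
     else - (p$\<mu>) * h u / 8)"

definition lower_matrix :: "(4 \<Rightarrow> real \<Rightarrow> real) \<Rightarrow> (real \<Rightarrow> real) \<Rightarrow> real^4 \<Rightarrow> real^4^4" where
  "lower_matrix a h p = (\<chi> \<mu> \<nu>. diagonal_part (\<lambda>A. a A (p$1 - p$0)) \<mu> \<nu>
     + du \<mu> * lower_coeff a h p \<nu> + lower_coeff a h p \<mu> * du \<nu>)"

definition upper_matrix :: "(4 \<Rightarrow> real \<Rightarrow> real) \<Rightarrow> (real \<Rightarrow> real) \<Rightarrow> real^4 \<Rightarrow> real^4^4" where
  "upper_matrix a h p = (\<chi> \<mu> \<nu>. diagonal_part (\<lambda>A. 1 / a A (p$1 - p$0)) \<mu> \<nu>
     + Lcomp \<mu> * upper_coeff a h p \<nu> + upper_coeff a h p \<mu> * Lcomp \<nu>)"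

lemmas matrix_defs = Lcomp_def du_def diagonal_part_def lower_coeff_def upper_coeff_def
  lower_matrix_def upper_matrix_def Let_def

lemma lower_upper_matrix:
  assumes "\<And>A. A \<in> {2, 3} \<Longrightarrow> a A (p$1 - p$0) \<noteq> 0"
  shows "lower_matrix a h p ** upper_matrix a h p = mat 1"
proof -
  have "a 2 (p$1 - p$0) \<noteq> 0" "a 3 (p$1 - p$0) \<noteq> 0"
    using assms by auto
  then show ?thesis
    by (simp add: vec_eq_iff forall_4_from_0 matrix_matrix_mult_def mat_def sum_4_from_0
        matrix_defs) (simp add: field_simps power2_eq_square)
qed

lemma det_lower_matrix:
  "det (lower_matrix a h p) = - a 2 (p$1 - p$0) * a 3 (p$1 - p$0)"
proof -
  have "lower_coeff a h p 1 = - lower_coeff a h p 0"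
    by (simp add: lower_coeff_def du_def Let_def)
  then show ?thesis
    by (simp add: det_4 lower_matrix_def diagonal_part_def du_def algebra_simps)
qed

lemma matrix_inv_eqI:
  fixes A B :: "'a::field^'n^'n"
  assumes "A ** B = mat 1"
  shows "invertible A" "matrix_inv A = B"
proof -
  have BA: "B ** A = mat 1"
    using assms matrix_left_right_inverse by blast
  show "invertible A"
    using assms BA invertible_def by blast
  have "A ** matrix_inv A = mat 1 \<and> matrix_inv A ** A = mat 1"
    unfolding matrix_inv_def by (rule someI[of _ B]) (use assms BA in simp)
  then show "matrix_inv A = B"
    by (metis BA matrix_mul_assoc matrix_mul_lid matrix_mul_rid)
qed

lemma components_eq_lower_matrix:
  assumes "is_metric_g \<epsilon> \<alpha> \<chi>\<^sub>2 M g" "p \<in> M"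
  shows "components g p = lower_matrix (chi1A \<epsilon> \<alpha>) \<chi>\<^sub>2 p"
proof -
  let ?g = "g p" and ?u = "p$1 - p$0"
  have bil: "bilinear ?g" and sym: "\<And>X Y. ?g X Y = ?g Y X"
    and LL: "?g vecL vecL = 0" "?g vecL vecLbar = -2" "?g vecLbar vecLbar = - (p$0) * \<chi>\<^sub>2 ?u"
    and A: "\<And>A. A \<in> {2, 3} \<Longrightarrow> ?g vecL (vecd A) = 0"
      "\<And>A. A \<in> {2, 3} \<Longrightarrow> ?g (vecd A) vecLbar = - (1/4) * p$A * chi2A \<epsilon> \<alpha> \<chi>\<^sub>2 A ?u"
    and AB: "\<And>A B. A \<in> {2, 3} \<Longrightarrow> B \<in> {2, 3} \<Longrightarrow>
      ?g (vecd A) (vecd B) = (if A = B then chi1A \<epsilon> \<alpha> A ?u else 0)"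
    using assms unfolding is_metric_g_def Let_def by blast+
  have d0: "vecd 0 = (1/2) *\<^sub>R (vecL + vecLbar)" and d1: "vecd 1 = (1/2) *\<^sub>R (vecL - vecLbar)"
    by (simp_all add: vecL_def vecLbar_def scaleR_add_right[symmetric] scaleR_2[symmetric])
  note bils = bilinear_ladd[OF bil] bilinear_radd[OF bil] bilinear_lsub[OF bil] bilinear_rsub[OF bil]
    bilinear_lmul[OF bil] bilinear_rmul[OF bil]
  have A': "?g (vecd A) vecL = 0" "?g vecLbar (vecd A) = - (1/4) * p$A * chi2A \<epsilon> \<alpha> \<chi>\<^sub>2 A ?u"
    if "A \<in> {2, 3}" for A
    using A[OF that] sym by metis+
  have L': "?g vecLbar vecL = -2"
    using LL(2) sym by metis
  show ?thesis
    by (simp add: components_def vec_eq_iff forall_4_from_0 d0 d1 bils LL L' A A' AB matrix_defs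
        chi2A_def field_simps)
qed

definition has_partial :: "4 \<Rightarrow> (real^4 \<Rightarrow> real) \<Rightarrow> real \<Rightarrow> real^4 \<Rightarrow> bool" where
  "has_partial \<mu> f d p \<longleftrightarrow> ((\<lambda>s. f (p + s *\<^sub>R vecd \<mu>)) has_real_derivative d) (at 0)"

lemma has_partialD:
  assumes "has_partial \<mu> f d p"
  shows "partial_differentiable \<mu> f p" "partial_deriv \<mu> f p = d"
  using assms by (auto simp: has_partial_def partial_differentiable_def partial_deriv_def
      real_differentiable_def intro: DERIV_imp_deriv)

lemma has_partial_cong:
  assumes "has_partial \<mu> f d p" "open S" "p \<in> S" "\<And>q. q \<in> S \<Longrightarrow> f q = f' q"
  shows "has_partial \<mu> f' d p"
proof -
  have "open ((\<lambda>s. p + s *\<^sub>R vecd \<mu>) -` S)"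
    by (intro open_vimage assms(2) continuous_intros)
  with assms(1) show ?thesis
    unfolding has_partial_def
    by (rule has_field_derivative_transform_within_open) (use assms(3,4) in auto)
qed

lemma has_partial_upper_matrix:
  assumes a: "\<And>A. A \<in> {2, 3} \<Longrightarrow> a A (p$1 - p$0) \<noteq> 0"
      "\<And>A. A \<in> {2, 3} \<Longrightarrow> (a A has_real_derivative a' A) (at (p$1 - p$0))"
    and h: "(h has_real_derivative h') (at (p$1 - p$0))"
  shows "\<exists>d. (\<forall>\<mu> \<nu>. has_partial \<mu> (\<lambda>q. upper_matrix a h q $ \<mu> $ \<nu>) (d \<mu> \<nu>) p)
    \<and> (\<forall>\<nu>. (\<Sum>\<mu>\<in>UNIV. d \<mu> \<nu>) = 0)"
proof -
  define \<delta> :: "4 \<Rightarrow> 4 \<Rightarrow> real" where "\<delta> \<mu> i = (if i = \<mu> then 1 else 0)" for \<mu> i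
  define e where "e \<mu> = \<delta> \<mu> 1 - \<delta> \<mu> 0" for \<mu>
  define u where "u = p$1 - p$0"
  define w where "w \<mu> \<nu> = (if \<nu> \<in> {0, 1}
     then \<delta> \<mu> 0 * h u / 8 + p$0 * h' * e \<mu> / 8
       + 2 * h u * h' * e \<mu> * (\<Sum>A\<in>{2, 3}. a A u * (p$A)\<^sup>2) / 128
       + (h u)\<^sup>2 * (\<Sum>A\<in>{2, 3}. a' A * e \<mu> * (p$A)\<^sup>2 + 2 * a A u * p$A * \<delta> \<mu> A) / 128
     else - \<delta> \<mu> \<nu> * h u / 8 - p$\<nu> * h' * e \<mu> / 8)" for \<mu> \<nu>
  define d where "d \<mu> \<kappa> \<nu> = (if \<kappa> = \<nu> \<and> \<nu> \<in> {2, 3} then - a' \<nu> * e \<mu> / (a \<nu> u)\<^sup>2 else 0)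
    + Lcomp \<kappa> * w \<mu> \<nu> + w \<mu> \<kappa> * Lcomp \<nu>" for \<mu> \<kappa> \<nu>
  have coord: "((\<lambda>s. (p + s *\<^sub>R vecd \<mu>) $ i) has_real_derivative \<delta> \<mu> i) (at 0)" for \<mu> i
    by (auto simp: \<delta>_def axis_def intro!: derivative_eq_intros)
  have arg: "((\<lambda>s. (p + s *\<^sub>R vecd \<mu>) $ 1 - (p + s *\<^sub>R vecd \<mu>) $ 0)
      has_real_derivative e \<mu>) (at 0)" for \<mu>
    unfolding e_def by (intro DERIV_diff coord)
  have ah: "((\<lambda>s. h ((p + s *\<^sub>R vecd \<mu>) $ 1 - (p + s *\<^sub>R vecd \<mu>) $ 0))
      has_real_derivative h' * e \<mu>) (at 0)" for \<mu>
    by (rule DERIV_chain2[OF _ arg]) (use h in simp)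
  have aa: "((\<lambda>s. a A ((p + s *\<^sub>R vecd \<mu>) $ 1 - (p + s *\<^sub>R vecd \<mu>) $ 0))
      has_real_derivative a' A * e \<mu>) (at 0)"
    if "A \<in> {2, 3}" for \<mu> A
    by (rule DERIV_chain2[OF _ arg]) (use a(2)[OF that] in simp)
  have ww: "((\<lambda>s. upper_coeff a h (p + s *\<^sub>R vecd \<mu>) \<nu>) has_real_derivative w \<mu> \<nu>) (at 0)" for \<mu> \<nu>
    unfolding upper_coeff_def w_def u_def Let_def
    by (cases "\<nu> \<in> {0, 1}")
      (auto simp del: vector_add_component vector_scaleR_component
        intro!: derivative_eq_intros coord ah aa, auto simp: field_simps power2_eq_square)
  have "((\<lambda>s. diagonal_part (\<lambda>A. 1 / a A ((p + s *\<^sub>R vecd \<mu>) $ 1 - (p + s *\<^sub>R vecd \<mu>) $ 0)) \<kappa> \<nu>)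
     has_real_derivative (if \<kappa> = \<nu> \<and> \<nu> \<in> {2, 3} then - a' \<nu> * e \<mu> / (a \<nu> u)\<^sup>2 else 0)) (at 0)"
    for \<mu> \<kappa> \<nu>
  proof (cases "\<kappa> = \<nu> \<and> \<nu> \<in> {2, 3}")
    case True
    then have "((\<lambda>s. inverse (a \<nu> ((p + s *\<^sub>R vecd \<mu>) $ 1 - (p + s *\<^sub>R vecd \<mu>) $ 0)))
        has_real_derivative - (inverse (a \<nu> u) * (a' \<nu> * e \<mu>) * inverse (a \<nu> u))) (at 0)"
      using DERIV_inverse'[OF aa[of \<nu> \<mu>]] a(1)[of \<nu>] by (simp add: u_def)
    with True show ?thesis
      by (auto simp: diagonal_part_def divide_inverse power2_eq_square mult_ac)
  next
    case False
    then have "\<kappa> \<noteq> \<nu> \<or> \<nu> = 0 \<or> \<nu> = 1"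
      using UNIV_4_from_0 by blast
    then have const: "diagonal_part b \<kappa> \<nu> = diagonal_part (\<lambda>_. 0) \<kappa> \<nu>" for b
      by (auto simp: diagonal_part_def)
    show ?thesis
      by (subst const, subst if_not_P[OF False]) simp
  qed
  then have partials: "has_partial \<mu> (\<lambda>q. upper_matrix a h q $ \<kappa> $ \<nu>) (d \<mu> \<kappa> \<nu>) p" for \<mu> \<kappa> \<nu>
    unfolding has_partial_def upper_matrix_def d_def vec_lambda_beta
    by (intro DERIV_add DERIV_cmult DERIV_cmult_right ww)
  have e_values: "e 0 = -1" "e 1 = 1" "e 2 = 0" "e 3 = 0"
    by (simp_all add: e_def \<delta>_def)
  have w_values: "w 0 \<nu> + w 1 \<nu> = (if \<nu> \<in> {0, 1} then h u / 8 else 0)"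
      "w 1 1 = w 1 0" "w 2 2 = - h u / 8" "w 3 3 = - h u / 8" for \<nu>
    by (simp_all add: w_def e_values) (auto simp: \<delta>_def field_simps)
  have divergence: "(\<Sum>\<mu>\<in>UNIV. d \<mu> \<mu> \<nu>) = 0" for \<nu>
  proof -
    have "(\<Sum>\<mu>\<in>UNIV. d \<mu> \<mu> \<nu>) = (w 0 \<nu> + w 1 \<nu>) + (w 0 0 + w 1 0 + w 2 2 + w 3 3) * Lcomp \<nu>"
      by (simp add: sum_4_from_0 d_def e_values Lcomp_def w_values(2) algebra_simps)
    also have "\<dots> = 0"
      unfolding w_values by (simp add: Lcomp_def)
    finally show ?thesis .
  qed
  show ?thesis
    using partials divergence by (intro exI[of _ "\<lambda>\<mu> \<nu>. d \<mu> \<mu> \<nu>"]) simp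
qed

theorem lemma3p4:
  fixes \<epsilon> \<alpha> :: real and \<chi>\<^sub>2 :: "real \<Rightarrow> real" and I :: "real set"
    and g :: "real^4 \<Rightarrow> real^4 \<Rightarrow> real^4 \<Rightarrow> real"
  assumes "\<epsilon> > 0" and "1/4 < \<alpha>" and "\<alpha> < 1/2"
    and "open I" and "0 \<notin> I" and "\<forall>y\<in>I. 1 + chi1 \<epsilon> \<alpha> y \<noteq> 0"
    and "ode_on \<epsilon> \<alpha> \<chi>\<^sub>2 I"
    and "is_metric_g \<epsilon> \<alpha> \<chi>\<^sub>2 (D_on I) g"
  shows "wave_coordinate_condition (D_on I) g"
  unfolding wave_coordinate_condition_def
proof
  let ?a = "chi1A \<epsilon> \<alpha>"
  have a: "?a 2 (q$1 - q$0) \<noteq> 0" "?a 3 (q$1 - q$0) \<noteq> 0" "?a 2 (q$1 - q$0) * ?a 3 (q$1 - q$0) = 1"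
    if "q \<in> D_on I" for q
    using that assms(6) by (auto simp: D_on_def chi1A_def)
  have inv: "invertible (components g q)" "matrix_inv (components g q) = upper_matrix ?a \<chi>\<^sub>2 q"
    if "q \<in> D_on I" for q
    using matrix_inv_eqI[OF lower_upper_matrix[of ?a q]] a[OF that]
      components_eq_lower_matrix[OF assms(8) that] by auto
  have dens: "upper_matrix ?a \<chi>\<^sub>2 q $ \<mu> $ \<nu> = densitized_inverse g \<mu> \<nu> q"
    if "q \<in> D_on I" for q \<mu> \<nu>
    using inv(2)[OF that] a(3)[OF that] components_eq_lower_matrix[OF assms(8) that]
    by (simp add: densitized_inverse_def det_lower_matrix)
  fix p
  assume p: "p \<in> D_on I"
  define u where "u = p$1 - p$0"
  have u: "u \<in> I" "u \<noteq> 0"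
    using p assms(5) by (auto simp: D_on_def u_def)
  obtain f' where f': "(chi1 \<epsilon> \<alpha> has_real_derivative f') (at u)"
    using chi1_differentiable[of \<alpha> u \<epsilon>] assms(2) u(2) by (auto simp: real_differentiable_def)
  obtain h' where h': "(\<chi>\<^sub>2 has_real_derivative h') (at u)"
    using assms(7) u(1) by (auto simp: ode_on_def real_differentiable_def)
  have "\<exists>a'. (?a A has_real_derivative a') (at u)" for A
  proof (cases "A = 2")
    case True
    have "((\<lambda>y. 1 + chi1 \<epsilon> \<alpha> y) has_real_derivative f') (at u)"
      using f' by (auto intro!: derivative_eq_intros)
    with True show ?thesis
      by (auto simp: chi1A_def[abs_def])
  next
    case False
    have "((\<lambda>y. 1 / (1 + chi1 \<epsilon> \<alpha> y)) has_real_derivative - f' / (1 + chi1 \<epsilon> \<alpha> u)\<^sup>2) (at u)"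
      using f' assms(6) u(1) by (auto intro!: derivative_eq_intros simp: power2_eq_square)
    with False show ?thesis
      by (auto simp: chi1A_def[abs_def])
  qed
  then obtain a' where a': "\<And>A. (?a A has_real_derivative a' A) (at u)"
    by metis
  have "\<exists>d. (\<forall>\<mu> \<nu>. has_partial \<mu> (\<lambda>q. upper_matrix ?a \<chi>\<^sub>2 q $ \<mu> $ \<nu>) (d \<mu> \<nu>) p)
    \<and> (\<forall>\<nu>. (\<Sum>\<mu>\<in>UNIV. d \<mu> \<nu>) = 0)"
    by (rule has_partial_upper_matrix[OF _ _ h'[unfolded u_def]])
      (use a[OF p] a'[unfolded u_def] in auto)
  then obtain d where d: "\<And>\<mu> \<nu>. has_partial \<mu> (\<lambda>q. upper_matrix ?a \<chi>\<^sub>2 q $ \<mu> $ \<nu>) (d \<mu> \<nu>) p"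
    "\<And>\<nu>. (\<Sum>\<mu>\<in>UNIV. d \<mu> \<nu>) = 0"
    by blast
  have "has_partial \<mu> (densitized_inverse g \<mu> \<nu>) (d \<mu> \<nu>) p" for \<mu> \<nu>
    by (rule has_partial_cong[OF d(1) open_D_on[OF assms(4)] p dens])
  then have "partial_differentiable \<mu> (densitized_inverse g \<mu> \<nu>) p"
    "partial_deriv \<mu> (densitized_inverse g \<mu> \<nu>) p = d \<mu> \<nu>" for \<mu> \<nu>
    using has_partialD by blast+
  then show "invertible (components g p) \<and>
     (\<forall>\<nu>. (\<forall>\<mu>. partial_differentiable \<mu> (densitized_inverse g \<mu> \<nu>) p) \<and>
          (\<Sum>\<mu>\<in>UNIV. partial_deriv \<mu> (densitized_inverse g \<mu> \<nu>) p) = 0)"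
    using inv(1)[OF p] d(2) by simp
qed

end
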